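(* Let $n\in\mathbb N$, $1<p<\infty$, and let $f\in C_c^\alpha(\mathbb R^n)$ for some $\alpha>0$. Then, for a certain constant $\alpha_{n,p}\in\mathbb R$ (depending only on $n$ and $p$), for every $x\in\mathbb R^n$, $$(\log(-\Delta)_p)f(x)=\lim_{t\to0^+}p\Big(\mathbb E_n\big(\Phi_p(f(x)-f(\cdot))-\Phi_p(f(x))\big)(x,t)-\Phi_p(f(x))\log t\Big)+\alpha_{n,p}\Phi_p(f(x)).$$
   Context: Functions are real-valued. For $\alpha=k+\sigma$ with $k\in\mathbb N\cup\{0\}$, $\sigma\in(0,1)$, $C_c^\alpha(\mathbb R^n)$ is the space of $k$-times continuously differentiable functions with compact support whose derivatives up to order $k$ are $\sigma$-Lipschitz (Hölder continuous of exponent $\sigma$) in $\mathbb R^n$. $\Phi_p(z)=|z|^{p-2}z$, with $\Phi_p(0)=0$. Extension operator: $$\mathbb E_n(g)(x,t)=\frac{\Gamma(n/2)}{2\pi^{n/2}}\int_{\mathbb R^n}\frac{g(z)}{(|x-z|^2+t^2)^{n/2}}\,dz,\qquad x\in\mathbb R^n,\ t>0.$$ In the claim, $x$ is fixed and $\mathbb E_n$ is applied to the function $y\mapsto\Phi_p(f(x)-f(y))-\Phi_p(f(x))$ and evaluated at $(x,t)$. Logarithmic $p$-Laplacian: $\log(-\Delta)_p$ is the operator for which $(-\Delta)_p^sf(x)=\Phi_p(f(x))+s(\log(-\Delta)_p)f(x)+o(s)$ as $s\to0^+$, where $(-\Delta)_p^sf(x)=c_{n,s,p}\,\mathrm{P.V.}\int_{\mathbb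 R^n}\frac{\Phi_p(f(x)-f(y))}{|x-y|^{n+sp}}dy$ is the suitably normalized fractional $p$-Laplacian. It is known, and may be taken as the definition of $\log(-\Delta)_p$ here, that for $f\in C_c^\alpha(\mathbb R^n)$, $\alpha>0$, $$(\log(-\Delta)_p)f(x)=\eta_{n,p}\int_{B(x,1)}\frac{\Phi_p(f(x)-f(y))}{|x-y|^n}dy+\eta_{n,p}\int_{\mathbb R^n\setminus B(x,1)}\frac{\Phi_p(f(x)-f(y))-\Phi_p(f(x))}{|x-y|^n}dy+\delta_{n,p}\Phi_p(f(x)),$$ where $\eta_{n,p}=\frac{p\,\Gamma(n/2)}{2\pi^{n/2}}$ and $\delta_{n,p}=2\log2-\gamma+\frac p2\psi(n/2)$, with $\gamma=-\Gamma'(1)$ the Euler–Mascheroni constant and $\psi=\Gamma'/\Gamma$ the digamma function. *)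

theory Defs
  imports "HOL-Analysis.Analysis"
begin

definition Phi :: "real \<Rightarrow> real \<Rightarrow> real" where
  "Phi p z = \<bar>z\<bar> powr (p - 2) * z"

definition partial_deriv :: "'n::finite \<Rightarrow> (real ^ 'n \<Rightarrow> real) \<Rightarrow> real ^ 'n \<Rightarrow> real" where
  "partial_deriv i f x = frechet_derivative f (at x) (axis i 1)"

definition iter_partial :: "'n::finite list \<Rightarrow> (real ^ 'n \<Rightarrow> real) \<Rightarrow> real ^ 'n \<Rightarrow> real" where
  "iter_partial is f = foldr partial_deriv is f"

definition Ck :: "nat \<Rightarrow> (real ^ 'n::finite \<Rightarrow> real) \<Rightarrow> bool" where
  "Ck k f \<longleftrightarrow>
     (\<forall>is. length is < k \<longrightarrow> (\<forall>x. iter_partial is f differentiable (at x))) \<and>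
     (\<forall>is. length is \<le> k \<longrightarrow> continuous_on UNIV (iter_partial is f))"

definition Holder :: "real \<Rightarrow> (real ^ 'n::finite \<Rightarrow> real) \<Rightarrow> bool" where
  "Holder \<sigma> g \<longleftrightarrow> (\<exists>C. \<forall>x y. \<bar>g x - g y\<bar> \<le> C * norm (x - y) powr \<sigma>)"

(* The space is empty when \<alpha> is an integer: the decomposition requires 0 < \<sigma> < 1. *)
definition Cc_space :: "real \<Rightarrow> (real ^ 'n::finite \<Rightarrow> real) set" where
  "Cc_space \<alpha> = {f. \<exists>(k::nat) \<sigma>. 0 < \<sigma> \<and> \<sigma> < 1 \<and> \<alpha> = real k + \<sigma> \<and>
      Ck k f \<and> compact (closure {x. f x \<noteq> 0}) \<and>
      (\<forall>is. length is \<le> k \<longrightarrow> Holder \<sigma> (iter_partial is f))}"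

definition ext_op :: "(real ^ 'n::finite \<Rightarrow> real) \<Rightarrow> real ^ 'n \<Rightarrow> real \<Rightarrow> real" where
  "ext_op g x t =
     Gamma (real CARD('n) / 2) / (2 * pi powr (real CARD('n) / 2)) *
     (LINT z|lborel. g z / ((norm (x - z))\<^sup>2 + t\<^sup>2) powr (real CARD('n) / 2))"

definition eta :: "nat \<Rightarrow> real \<Rightarrow> real" where
  "eta n p = p * Gamma (real n / 2) / (2 * pi powr (real n / 2))"

definition delta :: "nat \<Rightarrow> real \<Rightarrow> real" where
  "delta n p = 2 * ln 2 - euler_mascheroni + p / 2 * Digamma (real n / 2)"

(* For compactly supported Hoelder f this integral formula gives the first-order coefficient at
   s = 0 of the fractional p-Laplacian of order s; it is taken here as the definition. *)
definition log_p_laplacian :: "real \<Rightarrow> (real ^ 'n::finite \<Rightarrow> real) \<Rightarrow> real ^ 'n \<Rightarrow> real" where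
  "log_p_laplacian p f x =
     eta CARD('n) p * (LINT y:ball x 1|lborel. Phi p (f x - f y) / norm (x - y) ^ CARD('n)) +
     eta CARD('n) p * (LINT y:- ball x 1|lborel.
        (Phi p (f x - f y) - Phi p (f x)) / norm (x - y) ^ CARD('n)) +
     delta CARD('n) p * Phi p (f x)"

end

theory Submission
  imports Defs
begin

text \<open>
  Write \<open>h y = Phi p (f x - f y)\<close> and \<open>F = Phi p (f x)\<close>, so that the extension operator is applied
  to \<open>h - F\<close>. On the complement of the unit ball around \<open>x\<close> the function \<open>h - F\<close> is bounded with
  compact support, and on the ball \<open>h\<close> is dominated by a positive power of \<open>norm (x - y)\<close>
  (Hoelder continuity and \<open>1 < p\<close>); so the integrals of \<open>h\<close> over the ball and of \<open>h - F\<close> over its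
  complement converge to those in the logarithmic Laplacian. What remains is \<open>- F\<close> times the integral
  of the kernel over the ball. In polar coordinates the latter is
  \<open>J n t = integral {0..1} (\<lambda>r. r ^ (n - 1) / (r\<^sup>2 + t\<^sup>2) powr (n / 2))\<close>, and
  \<open>J n t + ln t\<close> converges as \<open>t\<close> tends to \<open>0\<close>: for \<open>n = 1, 2\<close> there is an elementary
  antiderivative, and \<open>J n t - J (n + 2) t\<close> is the increment of \<open>(r / sqrt (r\<^sup>2 + t\<^sup>2)) ^ n / n\<close>
  over \<open>{0..1}\<close>. The limit depends only on \<open>n\<close>, hence so does the constant.
\<close>

section \<open>Polar coordinates on a ball\<close>

text \<open>Both measures are finite on rays, so agreement on rays suffices. There the left side is
  a difference of ball volumes \<open>unit_ball_vol d * r ^ d\<close>, and the density is the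
  derivative of that volume in \<open>r\<close>.\<close>

lemma distr_dist_ball:
  fixes x :: "'a::euclidean_space"
  assumes "0 \<le> R"
  shows "distr (restrict_space lborel (ball x R)) borel (dist x) =
    density lborel (\<lambda>r. ennreal (indicator {0..R} r * (DIM('a) * unit_ball_vol DIM('a) * r ^ (DIM('a) - 1))))"
    (is "?M = ?N")
proof (rule measure_eqI_lessThan)
  let ?d = "DIM('a)" and ?V = "unit_ball_vol DIM('a)"
  have d: "dist x \<in> borel_measurable (restrict_space lborel (ball x R))"
    by (intro measurable_restrict_space1) auto
  have M: "emeasure ?M {r<..} = emeasure lborel (ball x R - cball x r)" for r
  proof -
    have "dist x -` {r<..} \<inter> space (restrict_space lborel (ball x R)) = ball x R - cball x r"
      by (auto simp: space_restrict_space)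
    then show ?thesis
      by (simp add: emeasure_distr[OF d] emeasure_restrict_space)
  qed
  show "emeasure ?M {r<..} < \<infinity>" for r
    unfolding M by (rule le_less_trans[OF emeasure_mono[of _ "ball x R"]])
      (auto simp: emeasure_ball assms less_top)
  show "emeasure ?M {r<..} = emeasure ?N {r<..}" for r
  proof -
    \<comment> \<open>\<open>s\<close> is \<open>r\<close> clamped to \<open>{0..R}\<close>: the ray
      beyond \<open>r\<close> meets \<open>{0..R}\<close> in \<open>{s..R}\<close>, except possibly
      at the null point \<open>s\<close>. This treats negative \<open>r\<close> and \<open>r\<close>
      beyond \<open>R\<close> uniformly.\<close>
    define s where "s = min R (max r 0)"
    have s: "0 \<le> s" "s \<le> R" using assms by (auto simp: s_def)
    have "emeasure ?N {r<..} = (\<integral>\<^sup>+y. ennreal (?d * ?V * y ^ (?d - 1)) * indicator {s..R} y \<partial>lborel)"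
    proof -
      have "AE y in lborel. ennreal (indicator {0..R} y * (?d * ?V * y ^ (?d - 1))) * indicator {r<..} y =
          ennreal (?d * ?V * y ^ (?d - 1)) * indicator {s..R} y"
        using AE_lborel_singleton[of s]
        by eventually_elim (auto simp: s_def indicator_def min_def max_def split: if_splits)
      then show ?thesis
        by (subst emeasure_density) (auto intro: nn_integral_cong_AE)
    qed
    also have "\<dots> = ennreal (?V * R ^ ?d - ?V * s ^ ?d)"
      by (rule nn_integral_FTC_Icc)
        (use s in \<open>auto intro!: derivative_eq_intros\<close>)
    also have "\<dots> = emeasure lborel (ball x R) - emeasure lborel (ball x R \<inter> cball x r)"
    proof (cases "0 \<le> r")
      case True
      show ?thesis
      proof (cases "r < R")
        case True
        then have "ball x R \<inter> cball x r = cball x r" by auto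
        then show ?thesis using True \<open>0 \<le> r\<close> assms
          by (simp add: emeasure_ball emeasure_cball ennreal_minus s_def)
      next
        case False
        then have "ball x R \<inter> cball x r = ball x R" by auto
        then show ?thesis using False \<open>0 \<le> r\<close> assms
          by (simp add: emeasure_ball ennreal_minus s_def)
      qed
    next
      case False
      then have "cball x r = {}" "s = 0" using assms by (auto simp: s_def)
      then show ?thesis using assms by (simp add: emeasure_ball)
    qed
    also have "\<dots> = emeasure lborel (ball x R - cball x r)"
    proof -
      have "emeasure lborel (ball x R - ball x R \<inter> cball x r) =
        emeasure lborel (ball x R) - emeasure lborel (ball x R \<inter> cball x r)"
        using emeasure_bounded_finite[of "ball x R \<inter> cball x r"]
        by (intro emeasure_Diff) (auto simp: bounded_Int)
      then show ?thesis by (simp add: Diff_Int_distrib Diff_Int)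
    qed
    finally show ?thesis by (simp add: M)
  qed
qed auto

text \<open>Transfer along \<open>dist x\<close>: the integral over the ball becomes one against the
  image measure, whose density is known. The equivalence for integrability is stated separately
  because the integral alone does not reveal it.\<close>

lemma radial_integral_ball:
  fixes x :: "'a::euclidean_space" and u :: "real \<Rightarrow> real"
  assumes "0 \<le> R" and [measurable]: "u \<in> borel_measurable borel"
  shows set_integrable_radial_iff: "set_integrable lborel (ball x R) (\<lambda>y. u (dist x y)) \<longleftrightarrow>
      set_integrable lborel {0..R} (\<lambda>r. DIM('a) * unit_ball_vol DIM('a) * r ^ (DIM('a) - 1) * u r)"
    and set_integral_radial: "(LINT y:ball x R|lborel. u (dist x y)) =
      (LINT r:{0..R}|lborel. DIM('a) * unit_ball_vol DIM('a) * r ^ (DIM('a) - 1) * u r)"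
proof -
  let ?w = "\<lambda>r. DIM('a) * unit_ball_vol DIM('a) * r ^ (DIM('a) - 1)"
  have d: "dist x \<in> borel_measurable (restrict_space lborel (ball x R))"
    by (intro measurable_restrict_space1) auto
  have w: "AE r in lborel. 0 \<le> indicator {0..R} r * ?w r"
    by (auto simp: indicator_def)
  note [measurable] = d
  have "set_integrable lborel (ball x R) (\<lambda>y. u (dist x y)) \<longleftrightarrow>
      integrable (restrict_space lborel (ball x R)) (\<lambda>y. u (dist x y))"
    by (simp add: set_integrable_def integrable_restrict_space)
  also have "\<dots> \<longleftrightarrow> integrable (density lborel (\<lambda>r. ennreal (indicator {0..R} r * ?w r))) u"
    unfolding distr_dist_ball[OF assms(1), of x, symmetric] by (rule integrable_distr_eq[symmetric]) auto
  also have "\<dots> \<longleftrightarrow> integrable lborel (\<lambda>r. (indicator {0..R} r * ?w r) *\<^sub>R u r)"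
    by (rule integrable_density) (use w in auto)
  finally show "set_integrable lborel (ball x R) (\<lambda>y. u (dist x y)) \<longleftrightarrow>
      set_integrable lborel {0..R} (\<lambda>r. ?w r * u r)"
    by (simp add: set_integrable_def mult.assoc)
  have "(LINT y:ball x R|lborel. u (dist x y)) =
      integral\<^sup>L (restrict_space lborel (ball x R)) (\<lambda>y. u (dist x y))"
    by (simp add: set_lebesgue_integral_def integral_restrict_space)
  also have "\<dots> = integral\<^sup>L (density lborel (\<lambda>r. ennreal (indicator {0..R} r * ?w r))) u"
    unfolding distr_dist_ball[OF assms(1), of x, symmetric] by (rule integral_distr[symmetric]) auto
  also have "\<dots> = integral\<^sup>L lborel (\<lambda>r. (indicator {0..R} r * ?w r) *\<^sub>R u r)"
    by (rule integral_density) (use w in auto)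
  finally show "(LINT y:ball x R|lborel. u (dist x y)) = (LINT r:{0..R}|lborel. ?w r * u r)"
    by (simp only: set_lebesgue_integral_def real_scaleR_def mult.assoc)
qed

section \<open>Logarithmic asymptotics of the radial kernel integral\<close>

text \<open>The product rule applied to \<open>(r / sqrt (r\<^sup>2 + t\<^sup>2)) ^ n / n\<close>
  yields exactly the difference of the two integrands. Its value at \<open>0\<close> vanishes since
  \<open>1 \<le> n\<close>; its value at \<open>1\<close> is the correction term.\<close>

lemma integral_Poisson_radial_Suc_Suc:
  fixes n :: nat and t :: real
  assumes "1 \<le> n" "0 < t"
  shows "integral {0..1} (\<lambda>r. r ^ (n + 1) / (r\<^sup>2 + t\<^sup>2) powr ((n + 2) / 2)) =
    integral {0..1} (\<lambda>r. r ^ (n - 1) / (r\<^sup>2 + t\<^sup>2) powr (n / 2)) - 1 / n * (1 + t\<^sup>2) powr (- (n / 2))"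
proof -
  let ?f = "\<lambda>r::real. r ^ (n - 1) / (r\<^sup>2 + t\<^sup>2) powr (n / 2)"
  let ?g = "\<lambda>r::real. r ^ (n + 1) / (r\<^sup>2 + t\<^sup>2) powr ((n + 2) / 2)"
  let ?G = "\<lambda>r::real. 1 / n * (r ^ n * (r\<^sup>2 + t\<^sup>2) powr (- (n / 2)))"
  have pos: "0 < r\<^sup>2 + t\<^sup>2" for r :: real
    using assms by (simp add: add_nonneg_pos)
  have "(?G has_real_derivative ?f r - ?g r) (at r within {0..1})" for r
  proof -
    have "(?G has_real_derivative
       1 / n * (n * r ^ (n - 1) * (r\<^sup>2 + t\<^sup>2) powr (- (n / 2)) +
        r ^ n * ((- (n / 2)) * (r\<^sup>2 + t\<^sup>2) powr (- (n / 2) - 1) * (2 * r)))) (at r within {0..1})"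
      using pos[of r] assms by (auto intro!: derivative_eq_intros simp: field_simps)
    also have "1 / n * (n * r ^ (n - 1) * (r\<^sup>2 + t\<^sup>2) powr (- (n / 2)) +
        r ^ n * ((- (n / 2)) * (r\<^sup>2 + t\<^sup>2) powr (- (n / 2) - 1) * (2 * r))) =
        r ^ (n - 1) * (r\<^sup>2 + t\<^sup>2) powr (- (n / 2)) - r ^ (n + 1) * (r\<^sup>2 + t\<^sup>2) powr (- ((n + 2) / 2))"
    proof -
      \<comment> \<open>The powers are abstracted to variables, so that only linear algebra remains
        and the exponents stay untouched.\<close>
      have "1 / n * (n * X * a + Y * (- (n / 2) * b * (2 * r))) = X * a - Y * r * b" for X Y a b :: real
        using assms by (simp add: field_simps)
      moreover have "- (real (n + 2) / 2) = - (n / 2) - 1" by (simp add: field_simps)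
      ultimately show ?thesis by (simp only: power_add power_one_right)
    qed
    also have "\<dots> = ?f r - ?g r"
      by (simp add: powr_minus_divide)
    finally show ?thesis .
  qed
  then have "((\<lambda>r. ?f r - ?g r) has_integral ?G 1 - ?G 0) {0..1}"
    by (intro fundamental_theorem_of_calculus) (auto simp: has_real_derivative_iff_has_vector_derivative)
  then have "integral {0..1} (\<lambda>r. ?f r - ?g r) = ?G 1 - ?G 0"
    by (rule integral_unique)
  moreover have "integral {0..1} (\<lambda>r. ?f r - ?g r) = integral {0..1} ?f - integral {0..1} ?g"
    using pos by (intro integral_diff integrable_continuous_real continuous_intros)
      (auto simp: add_nonneg_eq_0_iff order_less_imp_not_eq2)
  ultimately show ?thesis
    using assms by (simp add: zero_power)
qed

text \<open>Induction in steps of two: the limit is \<open>ln 2\<close> for \<open>n = 1\<close> and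
  \<open>0\<close> for \<open>n = 2\<close>, and passing from \<open>m\<close> to
  \<open>m + 2\<close> subtracts \<open>1 / m\<close>.\<close>

lemma integral_Poisson_radial_asymp:
  fixes n :: nat
  assumes "1 \<le> n"
  shows "\<exists>K. ((\<lambda>t. integral {0..1} (\<lambda>r. r ^ (n - 1) / (r\<^sup>2 + t\<^sup>2) powr (n / 2)) + ln t) \<longlongrightarrow> K) (at_right 0)"
  using assms
proof (induction n rule: less_induct)
  case (less n)
  have pos: "0 < r\<^sup>2 + t\<^sup>2" if "0 < t" for r t :: real
    using that by (simp add: add_nonneg_pos)
  consider "n = 1" | "n = 2" | m where "1 \<le> m" "n = m + 2"
  proof -
    have "n = 1 \<or> n = 2 \<or> 1 \<le> n - 2 \<and> n = n - 2 + 2"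
      using less.prems by linarith
    then show thesis using that by blast
  qed
  then show ?case
  proof cases
    case 1
    have "integral {0..1} (\<lambda>r. r ^ (n - 1) / (r\<^sup>2 + t\<^sup>2) powr (n / 2)) = ln (1 + sqrt (1 + t\<^sup>2)) - ln t"
      if "0 < t" for t :: real
    proof -
      \<comment> \<open>The antiderivative is arsinh of \<open>r / t\<close> up to a constant. Its
        value at \<open>r = 0\<close> is \<open>ln t\<close>, the singular term to be
        cancelled.\<close>
      have "((\<lambda>r. 1 / sqrt (r\<^sup>2 + t\<^sup>2)) has_integral
          ln (1 + sqrt (1\<^sup>2 + t\<^sup>2)) - ln (0 + sqrt (0\<^sup>2 + t\<^sup>2))) {0..1}"
      proof (rule fundamental_theorem_of_calculus)
        fix r :: real assume r: "r \<in> {0..1}"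
        have "0 < sqrt (r\<^sup>2 + t\<^sup>2)" using pos[OF that] by simp
        moreover from this r have "0 < r + sqrt (r\<^sup>2 + t\<^sup>2)" by (intro add_nonneg_pos) auto
        ultimately have "((\<lambda>r. ln (r + sqrt (r\<^sup>2 + t\<^sup>2))) has_real_derivative 1 / sqrt (r\<^sup>2 + t\<^sup>2)) (at r within {0..1})"
          using pos[OF that, of r] that
          by (auto intro!: derivative_eq_intros simp: field_simps)
        then show "((\<lambda>r. ln (r + sqrt (r\<^sup>2 + t\<^sup>2))) has_vector_derivative 1 / sqrt (r\<^sup>2 + t\<^sup>2)) (at r within {0..1})"
          by (simp add: has_real_derivative_iff_has_vector_derivative)
      qed auto
      then show ?thesis using 1 that pos
        by (auto simp: powr_half_sqrt less_imp_le dest: integral_unique)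
    qed
    then have "\<forall>\<^sub>F t in at_right 0. ln (1 + sqrt (1 + t\<^sup>2)) =
        integral {0..1} (\<lambda>r. r ^ (n - 1) / (r\<^sup>2 + t\<^sup>2) powr (n / 2)) + ln (t::real)"
      by (intro eventually_at_rightI[of 0 1]) auto
    moreover have "((\<lambda>t::real. ln (1 + sqrt (1 + t\<^sup>2))) \<longlongrightarrow> ln (1 + sqrt (1 + 0\<^sup>2))) (at_right 0)"
      by (intro tendsto_intros) auto
    ultimately show ?thesis by (blast intro: Lim_transform_eventually)
  next
    case 2
    have "integral {0..1} (\<lambda>r. r ^ (n - 1) / (r\<^sup>2 + t\<^sup>2) powr (n / 2)) = ln (1 + t\<^sup>2) / 2 - ln t"
      if "0 < t" for t :: real
    proof -
      \<comment> \<open>Here the lower endpoint contributes \<open>ln (t\<^sup>2) / 2\<close>, which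
        is again \<open>ln t\<close>.\<close>
      have "((\<lambda>r. r / (r\<^sup>2 + t\<^sup>2)) has_integral
          ln (1\<^sup>2 + t\<^sup>2) / 2 - ln (0\<^sup>2 + t\<^sup>2) / 2) {0..1}"
      proof (rule fundamental_theorem_of_calculus)
        fix r :: real assume r: "r \<in> {0..1}"
        have "((\<lambda>r. ln (r\<^sup>2 + t\<^sup>2) / 2) has_real_derivative r / (r\<^sup>2 + t\<^sup>2)) (at r within {0..1})"
          using pos[OF that, of r] that
          by (auto intro!: derivative_eq_intros simp: field_simps)
        then show "((\<lambda>r. ln (r\<^sup>2 + t\<^sup>2) / 2) has_vector_derivative r / (r\<^sup>2 + t\<^sup>2)) (at r within {0..1})"
          by (simp add: has_real_derivative_iff_has_vector_derivative)
      qed auto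
      then show ?thesis using 2 that pos
        by (auto simp: ln_realpow less_imp_le dest: integral_unique)
    qed
    then have "\<forall>\<^sub>F t in at_right 0. ln (1 + t\<^sup>2) / 2 =
        integral {0..1} (\<lambda>r. r ^ (n - 1) / (r\<^sup>2 + t\<^sup>2) powr (n / 2)) + ln (t::real)"
      by (intro eventually_at_rightI[of 0 1]) auto
    moreover have "((\<lambda>t::real. ln (1 + t\<^sup>2) / 2) \<longlongrightarrow> ln (1 + 0\<^sup>2) / 2) (at_right 0)"
      by (intro tendsto_intros) auto
    ultimately show ?thesis by (blast intro: Lim_transform_eventually)
  next
    case 3
    then obtain K where
      K: "((\<lambda>t. integral {0..1} (\<lambda>r. r ^ (m - 1) / (r\<^sup>2 + t\<^sup>2) powr (m / 2)) + ln t) \<longlongrightarrow> K) (at_right 0)"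
      using less.IH[of m] by auto
    have "((\<lambda>t::real. 1 / m * (1 + t\<^sup>2) powr (- (m / 2))) \<longlongrightarrow> 1 / m * (1 + 0\<^sup>2) powr (- (m / 2))) (at_right 0)"
      by (intro tendsto_intros) auto
    from tendsto_diff[OF K this]
    have "((\<lambda>t. integral {0..1} (\<lambda>r. r ^ (n - 1) / (r\<^sup>2 + t\<^sup>2) powr (n / 2)) + ln t)
      \<longlongrightarrow> K - 1 / m * (1 + 0\<^sup>2) powr (- (m / 2))) (at_right 0)"
    proof (rule Lim_transform_eventually)
      show "\<forall>\<^sub>F t in at_right 0. integral {0..1} (\<lambda>r. r ^ (m - 1) / (r\<^sup>2 + t\<^sup>2) powr (m / 2)) + ln t -
          1 / m * (1 + t\<^sup>2) powr (- (m / 2)) =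
          integral {0..1} (\<lambda>r. r ^ (n - 1) / (r\<^sup>2 + t\<^sup>2) powr (n / 2)) + ln t"
        using integral_Poisson_radial_Suc_Suc[of m] 3
        by (intro eventually_at_rightI[of 0 1]) (auto simp: add_ac)
    qed
    then show ?thesis by blast
  qed
qed

section \<open>Kernels integrated over the unit ball\<close>

text \<open>This is the area of the unit sphere. It is the reciprocal of the constant in
  \<open>ext_op\<close>, which is why \<open>ln t\<close> enters the theorem with coefficient
  exactly one inside the bracket.\<close>

lemma of_nat_mult_unit_ball_vol:
  assumes "0 < n"
  shows "real n * unit_ball_vol n = 2 * pi powr (n / 2) / Gamma (n / 2)"
proof -
  have "Gamma (real n / 2 + 1) = n / 2 * Gamma (n / 2)"
    by (rule Gamma_plus1) (use assms in auto)
  moreover have "0 < Gamma (real n / 2)"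
    by (rule Gamma_real_pos) (use assms in simp)
  ultimately show ?thesis
    unfolding unit_ball_vol_def using assms by (simp only:) (simp add: divide_simps)
qed

lemma set_integral_ball_Poisson_kernel:
  fixes x :: "'a::euclidean_space" and t :: real
  assumes "0 < t"
  shows "set_integrable lborel (ball x 1) (\<lambda>y. 1 / ((norm (x - y))\<^sup>2 + t\<^sup>2) powr (DIM('a) / 2))"
    and "Gamma (DIM('a) / 2) / (2 * pi powr (DIM('a) / 2)) *
        (LINT y:ball x 1|lborel. 1 / ((norm (x - y))\<^sup>2 + t\<^sup>2) powr (DIM('a) / 2)) =
      integral {0..1} (\<lambda>r. r ^ (DIM('a) - 1) / (r\<^sup>2 + t\<^sup>2) powr (DIM('a) / 2))"
proof -
  let ?d = "DIM('a)"
  let ?u = "\<lambda>r. 1 / (r\<^sup>2 + t\<^sup>2) powr (?d / 2)"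
  let ?w = "?d * unit_ball_vol ?d"
  have pos: "r\<^sup>2 + t\<^sup>2 \<noteq> 0" for r :: real
    using assms by (simp add: add_nonneg_eq_0_iff)
  have "continuous_on {0..1} (\<lambda>r. ?w * r ^ (?d - 1) * ?u r)"
    using pos by (intro continuous_intros) auto
  then have int: "set_integrable lborel {0..1} (\<lambda>r. ?w * r ^ (?d - 1) * ?u r)"
    by (rule borel_integrable_atLeastAtMost')
  then show "set_integrable lborel (ball x 1) (\<lambda>y. 1 / ((norm (x - y))\<^sup>2 + t\<^sup>2) powr (?d / 2))"
    using set_integrable_radial_iff[of 1 ?u x] by (simp add: dist_norm)
  have "(LINT y:ball x 1|lborel. 1 / ((norm (x - y))\<^sup>2 + t\<^sup>2) powr (?d / 2)) =
      (LINT r:{0..1}|lborel. ?w * r ^ (?d - 1) * ?u r)"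
    using set_integral_radial[of 1 ?u x] by (simp add: dist_norm)
  also have "\<dots> = integral {0..1} (\<lambda>r. ?w * r ^ (?d - 1) * ?u r)"
    by (rule set_borel_integral_eq_integral(2)[OF int])
  also have "\<dots> = ?w * integral {0..1} (\<lambda>r. r ^ (?d - 1) / (r\<^sup>2 + t\<^sup>2) powr (?d / 2))"
    by (simp flip: integral_mult_right add: mult.assoc)
  finally have "(LINT y:ball x 1|lborel. 1 / ((norm (x - y))\<^sup>2 + t\<^sup>2) powr (?d / 2)) =
      ?w * integral {0..1} (\<lambda>r. r ^ (?d - 1) / (r\<^sup>2 + t\<^sup>2) powr (?d / 2))" .
  moreover have "Gamma (?d / 2) \<noteq> 0"
    by (rule less_imp_neq[OF Gamma_real_pos, THEN not_sym]) simp
  ultimately show "Gamma (?d / 2) / (2 * pi powr (?d / 2)) *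
        (LINT y:ball x 1|lborel. 1 / ((norm (x - y))\<^sup>2 + t\<^sup>2) powr (?d / 2)) =
      integral {0..1} (\<lambda>r. r ^ (?d - 1) / (r\<^sup>2 + t\<^sup>2) powr (?d / 2))"
    by (simp add: of_nat_mult_unit_ball_vol)
qed

text \<open>Supplies the majorant near the singularity: in polar coordinates the integrand is a
  multiple of \<open>r powr (\<beta> - 1)\<close>, integrable at \<open>0\<close> because
  \<open>0 < \<beta>\<close>.\<close>

lemma set_integrable_ball_powr:
  fixes x :: "'a::euclidean_space"
  assumes "0 < \<beta>"
  shows "set_integrable lborel (ball x 1) (\<lambda>y. norm (x - y) powr \<beta> / norm (x - y) ^ DIM('a))"
proof -
  let ?d = "DIM('a)"
  have "(\<lambda>r. r powr (\<beta> - 1)) absolutely_integrable_on {0..1::real}"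
    using assms by (intro nonnegative_absolutely_integrable_1 integrable_on_powr_from_0) auto
  \<comment> \<open>Absolute integrability refers to the completed measure; Borel measurability
    brings it back to \<open>lborel\<close>.\<close>
  then have "set_integrable lborel {0..1::real} (\<lambda>r. r powr (\<beta> - 1))"
    unfolding set_integrable_def by (subst (asm) integrable_completion) auto
  then have "set_integrable lborel {0..1::real} (\<lambda>r. ?d * unit_ball_vol ?d * r powr (\<beta> - 1))"
    by (rule set_integrable_mult_right)
  also have "?this \<longleftrightarrow> set_integrable lborel {0..1::real}
      (\<lambda>r. ?d * unit_ball_vol ?d * r ^ (?d - 1) * (r powr \<beta> / r ^ ?d))"
  proof (intro set_integrable_cong refl)
    fix r :: real assume "r \<in> {0..1}"
    moreover have "r ^ ?d = r ^ (?d - 1) * r"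
      by (simp flip: power_Suc2)
    ultimately show "?d * unit_ball_vol ?d * r powr (\<beta> - 1) =
        ?d * unit_ball_vol ?d * r ^ (?d - 1) * (r powr \<beta> / r ^ ?d)"
      by (cases "r = 0") (auto simp: powr_diff)
  qed
  finally show ?thesis
    using set_integrable_radial_iff[of 1 "\<lambda>r. r powr \<beta> / r ^ ?d" x] by (simp add: dist_norm)
qed

section \<open>Passing to the limit in the regularized kernel\<close>

lemma power2_powr_half:
  fixes s :: real
  assumes "0 < s"
  shows "(s\<^sup>2) powr (n / 2) = s ^ n"
proof -
  have "(s\<^sup>2) powr (n / 2) = (s powr 2) powr (n / 2)"
    using assms by simp
  also have "\<dots> = s powr n"
    by (simp only: powr_powr) simp
  finally show ?thesis
    using assms by (simp add: powr_realpow)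
qed

lemma power_le_powr_half:
  fixes s t :: real
  assumes "0 \<le> s" "0 < n"
  shows "s ^ n \<le> (s\<^sup>2 + t\<^sup>2) powr (n / 2)"
proof (cases "s = 0")
  case True
  then show ?thesis using assms by (simp add: zero_power)
next
  case False
  then have "s ^ n = (s\<^sup>2) powr (n / 2)"
    using assms by (simp add: power2_powr_half)
  also have "\<dots> \<le> (s\<^sup>2 + t\<^sup>2) powr (n / 2)"
    by (intro powr_mono2) auto
  finally show ?thesis .
qed

lemma tendsto_powr_half:
  fixes s :: real
  assumes "0 < s"
  shows "((\<lambda>t. (s\<^sup>2 + t\<^sup>2) powr (n / 2)) \<longlongrightarrow> s ^ n) (at_right 0)"
proof -
  have "((\<lambda>t. (s\<^sup>2 + t\<^sup>2) powr (n / 2)) \<longlongrightarrow> (s\<^sup>2 + 0\<^sup>2) powr (n / 2)) (at_right 0)"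
    using assms by (intro tendsto_intros) auto
  also have "(s\<^sup>2 + 0\<^sup>2) powr (n / 2) = s ^ n"
    using assms by (simp add: power2_powr_half)
  finally show ?thesis .
qed

text \<open>Dominated convergence, with the singular integrand itself as majorant, since the
  regularized denominator is never smaller. At \<open>y = x\<close> that majorant is a quotient by
  zero and hence \<open>0\<close>, so the bound there rests on \<open>h x = 0\<close>.\<close>

lemma Poisson_integral_tendsto:
  fixes x :: "'a::euclidean_space" and h :: "'a \<Rightarrow> real"
  assumes [measurable]: "h \<in> borel_measurable borel" "A \<in> sets borel"
    and int: "set_integrable lborel A (\<lambda>y. h y / norm (x - y) ^ DIM('a))"
    and h0: "x \<in> A \<Longrightarrow> h x = 0"
  shows Poisson_set_integrable:
      "set_integrable lborel A (\<lambda>y. h y / ((norm (x - y))\<^sup>2 + t\<^sup>2) powr (DIM('a) / 2))"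
    and Poisson_set_integral_tendsto:
      "((\<lambda>t. LINT y:A|lborel. h y / ((norm (x - y))\<^sup>2 + t\<^sup>2) powr (DIM('a) / 2))
        \<longlongrightarrow> (LINT y:A|lborel. h y / norm (x - y) ^ DIM('a))) (at_right 0)"
proof -
  let ?d = "DIM('a)"
  have le: "norm (h y / ((norm (x - y))\<^sup>2 + t\<^sup>2) powr (?d / 2)) \<le> norm (h y / norm (x - y) ^ ?d)"
    if "y \<in> A" for y t
  proof (cases "y = x")
    case False
    then have "0 < norm (x - y) ^ ?d" by simp
    with power_le_powr_half[of "norm (x - y)" ?d t] show ?thesis
      by (auto simp: abs_mult intro!: divide_left_mono mult_pos_pos)
  qed (use h0 that in auto)
  show "set_integrable lborel A (\<lambda>y. h y / ((norm (x - y))\<^sup>2 + t\<^sup>2) powr (?d / 2))"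
    by (rule set_integrable_bound[OF int])
      (use le in \<open>auto simp: set_borel_measurable_def intro!: AE_I2\<close>)
  show "((\<lambda>t. LINT y:A|lborel. h y / ((norm (x - y))\<^sup>2 + t\<^sup>2) powr (?d / 2))
        \<longlongrightarrow> (LINT y:A|lborel. h y / norm (x - y) ^ ?d)) (at_right 0)"
    \<comment> \<open>Replacing \<open>t\<close> by \<open>inverse t\<close> turns the limit at
      \<open>0\<close> into one at infinity, the form in which dominated convergence is
      applied.\<close>
    unfolding filterlim_at_right_to_top set_lebesgue_integral_def
  proof (rule integral_dominated_convergence_at_top)
    show "integrable lborel (\<lambda>y. norm (indicator A y *\<^sub>R (h y / norm (x - y) ^ ?d)))"
      using int unfolding set_integrable_def by (rule integrable_norm)
    show "\<forall>\<^sub>F t in at_top. AE y in lborel.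
        norm (indicator A y *\<^sub>R (h y / ((norm (x - y))\<^sup>2 + (inverse t)\<^sup>2) powr (?d / 2)))
        \<le> norm (indicator A y *\<^sub>R (h y / norm (x - y) ^ ?d))"
      using le by (intro always_eventually allI AE_I2) (auto simp: indicator_def)
    show "AE y in lborel. ((\<lambda>t. indicator A y *\<^sub>R (h y / ((norm (x - y))\<^sup>2 + (inverse t)\<^sup>2) powr (?d / 2)))
        \<longlongrightarrow> indicator A y *\<^sub>R (h y / norm (x - y) ^ ?d)) at_top"
    proof (rule AE_I2)
      fix y
      show "((\<lambda>t. indicator A y *\<^sub>R (h y / ((norm (x - y))\<^sup>2 + (inverse t)\<^sup>2) powr (?d / 2)))
        \<longlongrightarrow> indicator A y *\<^sub>R (h y / norm (x - y) ^ ?d)) at_top"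
        using tendsto_powr_half[of "norm (x - y)" ?d] h0
        unfolding filterlim_at_right_to_top
        by (cases "y = x") (auto intro!: tendsto_intros simp: indicator_def)
    qed
  qed auto
qed

section \<open>Estimates for \<open>Phi\<close> and the limit formula\<close>

lemma abs_Phi: "\<bar>Phi p z\<bar> = \<bar>z\<bar> powr (p - 1)"
  using powr_add[of "\<bar>z\<bar>" "p - 2" 1] by (cases "z = 0") (auto simp: Phi_def abs_mult)

lemma borel_measurable_Phi [measurable]: "Phi p \<in> borel_measurable borel"
  unfolding Phi_def by measurable

theorem theorem1p4:
  fixes p :: real
  assumes "1 < p"
  shows "\<exists>c::real. \<forall>\<alpha>>0. \<forall>f \<in> (Cc_space \<alpha> :: (real ^ 'n::finite \<Rightarrow> real) set). \<forall>x.
    \<exists>L. ((\<lambda>t. p * (ext_op (\<lambda>y. Phi p (f x - f y) - Phi p (f x)) x t - Phi p (f x) * ln t))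
            \<longlongrightarrow> L) (at_right 0) \<and>
        log_p_laplacian p f x = L + c * Phi p (f x)"
proof -
  let ?n = "CARD('n)"
  define C where "C = Gamma (real ?n / 2) / (2 * pi powr (real ?n / 2))"
  obtain K where K: "((\<lambda>t. integral {0..1} (\<lambda>r. r ^ (?n - 1) / (r\<^sup>2 + t\<^sup>2) powr (?n / 2)) + ln t) \<longlongrightarrow> K) (at_right 0)"
    using integral_Poisson_radial_asymp[of ?n] by (auto simp: Suc_le_eq)
  show ?thesis
  \<comment> \<open>\<open>delta\<close> comes from the logarithmic Laplacian, and
    \<open>p * K\<close> compensates the limit of the kernel integral over the ball. The witness is
    fixed before \<open>\<alpha>\<close>, \<open>f\<close> and \<open>x\<close>.\<close>
  proof (rule exI[of _ "delta ?n p + p * K"], intro allI impI ballI)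
    fix \<alpha> :: real and f :: "real ^ 'n \<Rightarrow> real" and x :: "real ^ 'n"
    assume "f \<in> Cc_space \<alpha>"
    then obtain m \<sigma> where \<sigma>: "0 < \<sigma>" and f: "Ck m f" "compact (closure {x. f x \<noteq> 0})"
      and "\<forall>is. length is \<le> m \<longrightarrow> Holder \<sigma> (iter_partial is f)"
      by (auto simp: Cc_space_def)
    \<comment> \<open>The empty list of derivatives gives both properties for \<open>f\<close>
      itself, whatever \<open>m\<close> is.\<close>
    then have cont: "continuous_on UNIV f" and "Holder \<sigma> f"
      using f(1) by (auto simp: Ck_def iter_partial_def dest!: spec[of _ "[]"])
    then obtain H where H: "\<And>x y. \<bar>f x - f y\<bar> \<le> H * norm (x - y) powr \<sigma>"
      by (auto simp: Holder_def)
    have [measurable]: "f \<in> borel_measurable borel"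
      using cont by (rule borel_measurable_continuous_onI)
    define F where "F = Phi p (f x)"
    define h where "h = (\<lambda>y. Phi p (f x - f y))"
    define g where "g = (\<lambda>y. h y - F)"
    have meas [measurable]: "h \<in> borel_measurable borel" "g \<in> borel_measurable borel"
      by (simp_all add: h_def g_def)
    define k where "k = (\<lambda>t y. ((norm (x - y))\<^sup>2 + t\<^sup>2) powr (real ?n / 2))"
    have [measurable]: "ball x 1 \<in> sets borel"
      by simp
    have hx: "h x = 0"
      by (simp add: h_def Phi_def)
    have int_h: "set_integrable lborel (ball x 1) (\<lambda>y. h y / norm (x - y) ^ ?n)"
    proof (rule set_integrable_bound)
      show "set_integrable lborel (ball x 1)
          (\<lambda>y. \<bar>H\<bar> powr (p - 1) * (norm (x - y) powr (\<sigma> * (p - 1)) / norm (x - y) ^ ?n))"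
        using set_integrable_ball_powr[of "\<sigma> * (p - 1)" x] \<sigma> assms
        by (intro set_integrable_mult_right) simp
      \<comment> \<open>The exponent \<open>\<sigma> * (p - 1)\<close> is positive because
        \<open>1 < p\<close>. The absolute value of \<open>H\<close> appears because no sign of the
        Hoelder constant is given.\<close>
      have "\<bar>h y\<bar> \<le> \<bar>H\<bar> powr (p - 1) * norm (x - y) powr (\<sigma> * (p - 1))" for y
      proof -
        have "\<bar>f x - f y\<bar> \<le> \<bar>H\<bar> * norm (x - y) powr \<sigma>"
          by (rule order_trans[OF H]) (simp add: mult_right_mono)
        then have "\<bar>h y\<bar> \<le> (\<bar>H\<bar> * norm (x - y) powr \<sigma>) powr (p - 1)"
          unfolding h_def abs_Phi using assms by (intro powr_mono2) auto
        then show ?thesis by (simp add: powr_mult powr_powr)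
      qed
      then show "AE y in lborel. y \<in> ball x 1 \<longrightarrow> norm (h y / norm (x - y) ^ ?n) \<le>
          norm (\<bar>H\<bar> powr (p - 1) * (norm (x - y) powr (\<sigma> * (p - 1)) / norm (x - y) ^ ?n))"
        by (intro AE_I2) (simp add: abs_mult divide_right_mono)
    qed (unfold set_borel_measurable_def, measurable)
    have int_g: "set_integrable lborel (- ball x 1) (\<lambda>y. g y / norm (x - y) ^ ?n)"
    proof -
      define S where "S = closure {x. f x \<noteq> 0}"
      have S: "f y = 0" if "y \<notin> S" for y
        using that closure_subset[of "{x. f x \<noteq> 0}"] by (auto simp: S_def)
      have "compact (f ` S)"
        using f(2) cont unfolding S_def by (intro compact_continuous_image) (auto intro: continuous_on_subset)
      then have "\<exists>B. \<forall>y\<in>S. \<bar>f y\<bar> \<le> B"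
        by (auto dest!: compact_imp_bounded simp: bounded_iff)
      then obtain B where B: "\<And>y. y \<in> S \<Longrightarrow> \<bar>f y\<bar> \<le> B"
        by blast
      \<comment> \<open>Off the support \<open>f y = 0\<close>, so \<open>h y = F\<close> and
        \<open>g y = 0\<close>: subtracting \<open>F\<close> is what produces integrability at
        infinity.\<close>
      have g: "\<bar>g y\<bar> \<le> indicator S y *\<^sub>R ((\<bar>f x\<bar> + B) powr (p - 1) + \<bar>F\<bar>)" for y
      proof (cases "y \<in> S")
        case True
        have "\<bar>h y\<bar> \<le> (\<bar>f x\<bar> + B) powr (p - 1)"
          unfolding h_def abs_Phi using assms B[OF True] by (intro powr_mono2) auto
        then show ?thesis using True by (simp add: g_def)
      next
        case False
        then show ?thesis by (simp add: g_def h_def F_def S)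
      qed
      have "integrable lborel (\<lambda>y. indicator S y *\<^sub>R ((\<bar>f x\<bar> + B) powr (p - 1) + \<bar>F\<bar>))"
        using f(2) by (intro borel_integrable_compact) (auto simp: S_def)
      then have "integrable lborel g"
        by (rule Bochner_Integration.integrable_bound) (auto intro!: AE_I2 order_trans[OF g])
      then have "set_integrable lborel (- ball x 1) g"
        unfolding set_integrable_def by (intro integrable_mult_indicator) auto
      then show ?thesis
      proof (rule set_integrable_bound)
        have "\<bar>g y\<bar> / norm (x - y) ^ ?n \<le> \<bar>g y\<bar>" if "y \<notin> ball x 1" for y
        proof -
          have "1 \<le> norm (x - y) ^ ?n" using that by (intro one_le_power) (simp add: dist_norm)
          from mult_left_mono[OF this, of "\<bar>g y\<bar>"] show ?thesis by (simp add: divide_le_eq)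
        qed
        then show "AE y in lborel. y \<in> - ball x 1 \<longrightarrow> norm (g y / norm (x - y) ^ ?n) \<le> norm (g y)"
          by (intro AE_I2) simp
      qed (unfold set_borel_measurable_def, measurable)
    qed
    have dim: "DIM(real ^ 'n) = ?n"
      by simp
    note h = Poisson_integral_tendsto[of h "ball x 1" x, unfolded dim, OF meas(1) _ int_h hx]
      and g = Poisson_integral_tendsto[of g "- ball x 1" x, unfolded dim, OF meas(2) _ int_g]
    have h: "set_integrable lborel (ball x 1) (\<lambda>y. h y / k t y)"
      "((\<lambda>t. LINT y:ball x 1|lborel. h y / k t y)
        \<longlongrightarrow> (LINT y:ball x 1|lborel. h y / norm (x - y) ^ ?n)) (at_right 0)" for t
      unfolding k_def by (rule h; simp)+
    \<comment> \<open>The vanishing condition at \<open>x\<close> holds vacuously here, since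
      \<open>x\<close> lies in the ball.\<close>
    have g: "set_integrable lborel (- ball x 1) (\<lambda>y. g y / k t y)"
      "((\<lambda>t. LINT y:- ball x 1|lborel. g y / k t y)
        \<longlongrightarrow> (LINT y:- ball x 1|lborel. g y / norm (x - y) ^ ?n)) (at_right 0)" for t
      unfolding k_def by (rule g; simp)+
    let ?J = "\<lambda>t. integral {0..1} (\<lambda>r. r ^ (?n - 1) / (r\<^sup>2 + t\<^sup>2) powr (?n / 2))"
    \<comment> \<open>\<open>?E\<close> groups the divergent kernel integral with
      \<open>ln t\<close>, so that each summand converges separately.\<close>
    let ?E = "\<lambda>t. p * C * (LINT y:ball x 1|lborel. h y / k t y) +
        p * C * (LINT y:- ball x 1|lborel. g y / k t y) - p * F * (?J t + ln t)"
    let ?L = "p * C * (LINT y:ball x 1|lborel. h y / norm (x - y) ^ ?n) +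
        p * C * (LINT y:- ball x 1|lborel. g y / norm (x - y) ^ ?n) - p * F * K"
    have ext: "?E t = p * (ext_op g x t - F * ln t)" if "0 < t" for t
    proof -
      have one: "set_integrable lborel (ball x 1) (\<lambda>y. 1 / k t y)"
        "C * (LINT y:ball x 1|lborel. 1 / k t y) = ?J t"
        using set_integral_ball_Poisson_kernel[OF that, of x] by (simp_all add: k_def C_def)
      \<comment> \<open>On the ball \<open>g\<close> is split back into \<open>h\<close> and the
        constant \<open>F\<close>. Both pieces are integrable for fixed \<open>0 < t\<close>; only
        the second diverges as \<open>t\<close> tends to \<open>0\<close>.\<close>
      have split: "g y / k t y = h y / k t y - F * (1 / k t y)" for y
        by (simp add: g_def diff_divide_distrib)
      have intF: "set_integrable lborel (ball x 1) (\<lambda>y. F * (1 / k t y))"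
        using one(1) by (rule set_integrable_mult_right)
      have int: "set_integrable lborel (ball x 1) (\<lambda>y. g y / k t y)"
        unfolding split by (intro set_integral_diff h intF)
      have "(LINT y|lborel. g y / k t y) = (LINT y:ball x 1 \<union> - ball x 1|lborel. g y / k t y)"
        by (simp add: set_lebesgue_integral_def)
      also have "\<dots> = (LINT y:ball x 1|lborel. g y / k t y) + (LINT y:- ball x 1|lborel. g y / k t y)"
        by (intro set_integral_Un int g) auto
      also have "(LINT y:ball x 1|lborel. g y / k t y) =
          (LINT y:ball x 1|lborel. h y / k t y) - F * (LINT y:ball x 1|lborel. 1 / k t y)"
        unfolding split by (simp only: set_integral_diff(2)[OF h(1) intF] set_integral_mult_right)
      finally have ext: "ext_op g x t = C * ((LINT y:ball x 1|lborel. h y / k t y) -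
          F * (LINT y:ball x 1|lborel. 1 / k t y) + (LINT y:- ball x 1|lborel. g y / k t y))"
        by (simp add: ext_op_def C_def k_def)
      show ?thesis
        unfolding one(2)[symmetric] ext by (simp add: algebra_simps)
    qed
    have "(?E \<longlongrightarrow> ?L) (at_right 0)"
      by (intro tendsto_add tendsto_diff tendsto_mult tendsto_const h(2) g(2) K)
    then have lim: "((\<lambda>t. p * (ext_op g x t - F * ln t)) \<longlongrightarrow> ?L) (at_right 0)"
    proof (rule Lim_transform_eventually)
      show "\<forall>\<^sub>F t in at_right 0. ?E t = p * (ext_op g x t - F * ln t)"
        by (rule eventually_at_rightI[of 0 1], rule ext) simp_all
    qed
    have "eta ?n p = p * C"
      by (simp add: eta_def C_def)
    then have "log_p_laplacian p f x = p * C * (LINT y:ball x 1|lborel. h y / norm (x - y) ^ ?n) +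
        p * C * (LINT y:- ball x 1|lborel. g y / norm (x - y) ^ ?n) + delta ?n p * F"
      unfolding log_p_laplacian_def g_def h_def F_def by (simp only:)
    \<comment> \<open>The term \<open>p * K * F\<close> cancels the \<open>- p * F * K\<close>
      contained in \<open>?L\<close>.\<close>
    also have "\<dots> = ?L + (delta ?n p + p * K) * F"
      by (simp add: distrib_right)
    finally have "log_p_laplacian p f x = ?L + (delta ?n p + p * K) * F" .
    with lim show "\<exists>L. ((\<lambda>t. p * (ext_op (\<lambda>y. Phi p (f x - f y) - Phi p (f x)) x t - Phi p (f x) * ln t))
        \<longlongrightarrow> L) (at_right 0) \<and> log_p_laplacian p f x = L + (delta ?n p + p * K) * Phi p (f x)"
      unfolding g_def h_def F_def by blast
  qed
qed

end
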